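(* Let $G$ be a connected (finite, simple) graph. (i) If $\Delta(G)\ge |G|-3$, then $G$ has an antimagic orientation. (ii) If $\Delta(G)=|G|-t\ge 4$ for some $t\in\{4,5\}$, then $G$ has an antimagic orientation.
   Context: All graphs are finite and simple; $|G|$ is the number of vertices of $G$ and $\Delta(G)$ its maximum degree. For a digraph $D$ and an injective map $\tau$ from the arc set $A(D)$ to a set of positive integers, and a vertex $u$, define $s_{(D,\tau)}(u)$ to be the sum of the labels $\tau(a)$ over all arcs $a$ entering $u$ minus the sum of labels over all arcs leaving $u$ (and $s_{(D,\tau)}(u)=0$ if $u$ is isolated). If $D$ has $m$ arcs, a bijection $\tau:A(D)\to\{1,\dots,m\}$ is an antimagic labeling of $D$ if $s_{(D,\tau)}(u)\ne s_{(D,\tau)}(v)$ for all distinct vertices $u,v$. A pair $(D,\tau)$ is an antimagic orientation of a graph $G$ if $D$ is an orientation of $G$ (each edge is given one direction) and $\tau$ is an antimagic labeling of $D$; we say $G$ has (admits) an antimagic orientation if such a pair exists. *)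

theory Defs
  imports Main
begin

text \<open>A finite simple graph: finite vertex set V, edge set E of 2-element subsets of V.\<close>
definition simple_graph :: "'a set \<Rightarrow> 'a set set \<Rightarrow> bool" where
  "simple_graph V E \<longleftrightarrow> finite V \<and> (\<forall>e\<in>E. e \<subseteq> V \<and> card e = 2)"

definition adjacent :: "'a set set \<Rightarrow> 'a \<Rightarrow> 'a \<Rightarrow> bool" where
  "adjacent E u v \<longleftrightarrow> {u, v} \<in> E"

text \<open>Connected: nonempty and any two vertices joined by a path.\<close>
definition connected_graph :: "'a set \<Rightarrow> 'a set set \<Rightarrow> bool" where
  "connected_graph V E \<longleftrightarrow> V \<noteq> {} \<and>
     (\<forall>u\<in>V. \<forall>v\<in>V. (u, v) \<in> {(x, y). adjacent E x y}\<^sup>*)"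

definition degree :: "'a set set \<Rightarrow> 'a \<Rightarrow> nat" where
  "degree E v = card {e \<in> E. v \<in> e}"

definition max_degree :: "'a set \<Rightarrow> 'a set set \<Rightarrow> nat" where
  "max_degree V E = Max (degree E ` V)"

text \<open>An orientation of (V,E): a set of arcs containing exactly one direction of each edge.\<close>
definition is_orientation :: "'a set set \<Rightarrow> ('a \<times> 'a) set \<Rightarrow> bool" where
  "is_orientation E D \<longleftrightarrow>
     (\<forall>(u, v)\<in>D. {u, v} \<in> E) \<and>
     (\<forall>e\<in>E. \<exists>!a. a \<in> D \<and> e = {fst a, snd a})"

text \<open>Oriented vertex sum: labels of arcs entering u minus labels of arcs leaving u.\<close>
definition vsum :: "('a \<times> 'a) set \<Rightarrow> ('a \<times> 'a \<Rightarrow> nat) \<Rightarrow> 'a \<Rightarrow> int" where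
  "vsum D \<tau> u = (\<Sum>a\<in>{a\<in>D. snd a = u}. int (\<tau> a)) - (\<Sum>a\<in>{a\<in>D. fst a = u}. int (\<tau> a))"

definition antimagic_labeling :: "'a set \<Rightarrow> ('a \<times> 'a) set \<Rightarrow> ('a \<times> 'a \<Rightarrow> nat) \<Rightarrow> bool" where
  "antimagic_labeling V D \<tau> \<longleftrightarrow> bij_betw \<tau> D {1..card D} \<and> inj_on (vsum D \<tau>) V"

definition has_antimagic_orientation :: "'a set \<Rightarrow> 'a set set \<Rightarrow> bool" where
  "has_antimagic_orientation V E \<longleftrightarrow>
     (\<exists>D \<tau>. is_orientation E D \<and> antimagic_labeling V D \<tau>)"

end

theory Submission
  imports Defs "HOL-Library.Multiset"
begin

text \<open>
  Let \<open>x\<close> have maximum degree, \<open>N\<close> be its neighbourhood, \<open>W\<close> the set of the at most four remaining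
  vertices, and \<open>A \<subseteq> W\<close> the vertices with a neighbour in \<open>N\<close>. Pick an edge from each \<open>a \<in> A\<close> to \<open>N\<close>. These
  edges, oriented out of \<open>a\<close>, and the edges at \<open>x\<close>, oriented out of \<open>x\<close>, get the largest labels, and the
  other edges between \<open>A\<close> and \<open>N\<close> are oriented towards \<open>N\<close>. Splitting the edges inside \<open>N\<close> into trails with
  distinct starts, labelled decreasingly, no sum inside \<open>N\<close> drops below minus the largest label used there.
  Hence all sums in \<open>N\<close> exceed a bound \<open>u\<close>, and they become distinct if the labels at \<open>x\<close> are increasing
  in the sums obtained so far, while \<open>x\<close> itself has by far the smallest sum. The sums in \<open>W\<close> are kept at most
  \<open>u\<close>: on the at most four vertices of \<open>W\<close> a finite check yields a labelling with distinct sums outside \<open>A\<close>,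
  and the sums in \<open>A\<close> are separated by the choice of the labels on the picked edges.
\<close>

subsection \<open>Labelled orientations as lists\<close>

text \<open>A labelled orientation is a list of triples (tail, head, label).\<close>
definition net :: "('a \<times> 'a \<times> nat) list \<Rightarrow> 'a \<Rightarrow> int" where
  "net xs v = (\<Sum>(u, w, l)\<leftarrow>xs. (if w = v then int l else 0) - (if u = v then int l else 0))"

text \<open>Edges and labels are required to be repetition-free separately, which makes the list a
  bijection between \<open>F\<close> and \<open>L\<close>. Keeping \<open>L\<close> arbitrary lets
  labellings of disjoint edge sets with disjoint label sets be concatenated.\<close>

definition labelled :: "('a \<times> 'a \<times> nat) list \<Rightarrow> 'a set set \<Rightarrow> nat set \<Rightarrow> bool" where
  "labelled xs F L \<longleftrightarrow>
     distinct (map (\<lambda>(u, v, l). {u, v}) xs) \<and> (\<lambda>(u, v, l). {u, v}) ` set xs = F \<and>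
     distinct (map (\<lambda>(u, v, l). l) xs) \<and> (\<lambda>(u, v, l). l) ` set xs = L"

lemma net_Nil [simp]: "net [] v = 0"
  by (simp add: net_def)

lemma net_Cons [simp]:
  "net ((u, w, l) # xs) v = (if w = v then int l else 0) - (if u = v then int l else 0) + net xs v"
  by (simp add: net_def)

lemma net_append [simp]: "net (xs @ ys) v = net xs v + net ys v"
  by (simp add: net_def)

lemma labelled_append:
  assumes "labelled xs F L" "labelled ys F' L'" "F \<inter> F' = {}" "L \<inter> L' = {}"
  shows "labelled (xs @ ys) (F \<union> F') (L \<union> L')"
  using assms by (simp add: labelled_def image_Un)

lemma labelled_distinct: "labelled xs F L \<Longrightarrow> distinct xs"
  by (simp add: labelled_def distinct_map)

lemma labelled_edge: "labelled xs F L \<Longrightarrow> (u, w, l) \<in> set xs \<Longrightarrow> {u, w} \<in> F \<and> l \<in> L"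
  using imageI[of "(u, w, l)" "set xs" "\<lambda>(u, v, l). {u, v}"] imageI[of "(u, w, l)" "set xs" "\<lambda>(u, v, l). l"]
  by (simp add: labelled_def)

lemma net_nonpos: "(\<And>u w l. (u, w, l) \<in> set xs \<Longrightarrow> w \<noteq> v) \<Longrightarrow> net xs v \<le> 0"
proof (induction xs)
  case (Cons t xs)
  obtain u w l where t: "t = (u, w, l)" by (cases t)
  have "net xs v \<le> 0" by (rule Cons.IH) (meson Cons.prems list.set_intros(2))
  moreover have "w \<noteq> v" using Cons.prems[of u w l] t by simp
  ultimately show ?case by (simp add: t)
qed simp

lemma net_nonneg: "(\<And>u w l. (u, w, l) \<in> set xs \<Longrightarrow> u \<noteq> v) \<Longrightarrow> net xs v \<ge> 0"
proof (induction xs)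
  case (Cons t xs)
  obtain u w l where t: "t = (u, w, l)" by (cases t)
  have "net xs v \<ge> 0" by (rule Cons.IH) (meson Cons.prems list.set_intros(2))
  moreover have "u \<noteq> v" using Cons.prems[of u w l] t by simp
  ultimately show ?case by (simp add: t)
qed simp

lemma net_zero:
  assumes "labelled xs F L" "\<And>e. e \<in> F \<Longrightarrow> v \<notin> e" shows "net xs v = 0"
proof -
  have "u \<noteq> v \<and> w \<noteq> v" if "(u, w, l) \<in> set xs" for u w l
    using labelled_edge[OF assms(1) that] assms(2) by blast
  then have "net xs v \<le> 0" "net xs v \<ge> 0"
    by (blast intro: net_nonpos net_nonneg)+
  then show ?thesis by simp
qed

text \<open>Each edge at \<open>v\<close> lowers the sum by at most \<open>M\<close>, and since
  edges do not repeat, the triples meeting \<open>v\<close> number exactly its degree. This crude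
  bound is what separates the vertices of \<open>W\<close> from \<open>x\<close>.\<close>

lemma net_ge_degree:
  assumes "labelled xs F L" "\<And>l. l \<in> L \<Longrightarrow> l \<le> M"
  shows "net xs v \<ge> - int (M * degree F v)"
proof -
  have "net ys v \<ge> - int (M * length (filter (\<lambda>(u, w, l). v \<in> {u, w}) ys))"
    if "\<forall>(u, w, l)\<in>set ys. l \<le> M" for ys
    using that by (induction ys) (auto simp: algebra_simps split: if_splits)
  moreover have "\<forall>(u, w, l)\<in>set xs. l \<le> M"
    using labelled_edge[OF assms(1)] assms(2) by auto
  moreover have "length (filter (\<lambda>(u, w, l). v \<in> {u, w}) xs) = degree F v"
  proof -
    have "{e \<in> F. v \<in> e} = (\<lambda>(u, w, l). {u, w}) ` set (filter (\<lambda>(u, w, l). v \<in> {u, w}) xs)"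
    proof -
      have F: "F = (\<lambda>(u, w, l). {u, w}) ` set xs" using assms(1) by (simp add: labelled_def)
      show ?thesis unfolding F by auto
    qed
    moreover have "inj_on (\<lambda>(u, w, l). {u, w}) (set xs)"
      using assms(1) by (simp add: labelled_def distinct_map)
    ultimately have "degree F v = card (set (filter (\<lambda>(u, w, l). v \<in> {u, w}) xs))"
      unfolding degree_def by (metis (no_types, lifting) card_image filter_is_subset inj_on_subset)
    also have "\<dots> = length (filter (\<lambda>(u, w, l). v \<in> {u, w}) xs)"
      using labelled_distinct[OF assms(1)] by (metis distinct_card distinct_filter)
    finally show ?thesis by simp
  qed
  ultimately show ?thesis by fastforce
qed

text \<open>Triples are determined by their edges, hence also by their arcs. So the label can be
  read off as a function of the arc, and \<open>net\<close> turns into \<open>vsum\<close>.\<close>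

lemma antimagic_of_labelled:
  assumes xs: "labelled xs E {1..card E}" and inj: "inj_on (net xs) V"
  shows "has_antimagic_orientation V E"
proof -
  let ?arc = "\<lambda>(u, v, l). (u, v)"
  let ?edge = "\<lambda>(u, v, l). {u, v}"
  let ?lab = "\<lambda>(u, v, l). l"
  define D where "D = ?arc ` set xs"
  have inj_e: "inj_on ?edge (set xs)" and inj_l: "inj_on ?lab (set xs)"
    and E: "?edge ` set xs = E" and L: "?lab ` set xs = {1..card E}"
    using xs by (simp_all add: labelled_def distinct_map)
  have inj_a: "inj_on ?arc (set xs)"
  proof (rule inj_onI)
    fix s t assume st: "s \<in> set xs" "t \<in> set xs" "?arc s = ?arc t"
    have "?edge s = ?edge t" using st(3) by (simp split: prod.splits)
    then show "s = t" using inj_e st by (meson inj_onD)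
  qed
  define \<tau> where "\<tau> a = ?lab (the_inv_into (set xs) ?arc a)" for a
  have \<tau>: "\<tau> (?arc t) = ?lab t" if "t \<in> set xs" for t
    using that inj_a by (simp add: \<tau>_def the_inv_into_f_f)
  have fin: "finite D" by (simp add: D_def)
  have cardD: "card D = card E"
    unfolding D_def E[symmetric] using card_image[OF inj_a] card_image[OF inj_e] by simp
  have "is_orientation E D"
    unfolding is_orientation_def
  proof (intro conjI ballI)
    fix a assume "a \<in> D"
    then obtain u v l where "(u, v, l) \<in> set xs" "a = (u, v)" by (auto simp: D_def)
    then show "case a of (u, v) \<Rightarrow> {u, v} \<in> E" using labelled_edge[OF xs] by simp
  next
    fix e assume "e \<in> E"
    then obtain t where t: "t \<in> set xs" "e = ?edge t" using E by blast
    show "\<exists>!a. a \<in> D \<and> e = {fst a, snd a}"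
    proof (rule ex1I[of _ "?arc t"])
      show "?arc t \<in> D \<and> e = {fst (?arc t), snd (?arc t)}"
        using t(2) imageI[OF t(1), of ?arc] by (simp add: D_def split: prod.splits)
      fix b assume b: "b \<in> D \<and> e = {fst b, snd b}"
      then obtain s where s: "s \<in> set xs" "b = ?arc s" by (auto simp: D_def)
      then have "?edge s = ?edge t" using b t(2) by (simp split: prod.splits)
      then show "b = ?arc t" using inj_e s t by (metis inj_onD)
    qed
  qed
  moreover have "bij_betw \<tau> D {1..card D}"
  proof -
    have "bij_betw ?lab (set xs) {1..card E}" using inj_l L by (simp add: bij_betw_def)
    moreover have "bij_betw (the_inv_into (set xs) ?arc) D (set xs)"
      using bij_betw_the_inv_into[of ?arc "set xs" D] inj_a by (simp add: bij_betw_def D_def)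
    ultimately have "bij_betw (?lab \<circ> the_inv_into (set xs) ?arc) D {1..card E}"
      using bij_betw_trans by blast
    then show ?thesis by (simp add: cardD comp_def \<tau>_def[abs_def])
  qed
  moreover have "vsum D \<tau> v = net xs v" for v
  proof -
    have "vsum D \<tau> v = (\<Sum>a\<in>D. (if snd a = v then int (\<tau> a) else 0) - (if fst a = v then int (\<tau> a) else 0))"
      unfolding vsum_def using fin by (simp add: sum_subtractf sum.inter_filter)
    also have "\<dots> = (\<Sum>t\<in>set xs. (if snd (?arc t) = v then int (\<tau> (?arc t)) else 0)
                    - (if fst (?arc t) = v then int (\<tau> (?arc t)) else 0))"
      unfolding D_def using inj_a by (subst sum.reindex) auto
    also have "\<dots> = (\<Sum>(u, w, l)\<in>set xs. (if w = v then int l else 0) - (if u = v then int l else 0))"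
      by (rule sum.cong) (use \<tau> in \<open>auto split: prod.splits\<close>)
    also have "\<dots> = net xs v"
      unfolding net_def using labelled_distinct[OF xs] by (simp add: sum_list_distinct_conv_sum_set)
    finally show ?thesis .
  qed
  ultimately show ?thesis
    unfolding has_antimagic_orientation_def antimagic_labeling_def using inj
    by (intro exI[of _ D] exI[of _ \<tau>]) (simp add: inj_on_def)
qed

text \<open>Giving the largest label to the smallest base value yields a sum below all others;
  if that sum is forbidden, the label can be discarded together with the forbidden value.\<close>
lemma distinct_differences:
  fixes b :: "'a \<Rightarrow> int" and P :: "nat set"
  assumes "finite A" "finite P" "finite X" "card A + card X \<le> card P"
  shows "\<exists>f. inj_on f A \<and> f ` A \<subseteq> P \<and> inj_on (\<lambda>a. b a - int (f a)) A \<and> (\<forall>a\<in>A. b a - int (f a) \<notin> X)"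
  using assms
proof (induction "card P" arbitrary: A P X rule: less_induct)
  case less
  show ?case
  proof (cases "A = {}")
    case False
    obtain a0 where a0: "a0 \<in> A" "\<And>a. a \<in> A \<Longrightarrow> b a0 \<le> b a"
      using ex_is_arg_min_if_finite[OF less.prems(1) False, of b] by (auto simp: is_arg_min_linorder)
    have "card A > 0" using False less.prems(1) by (simp add: card_gt_0_iff)
    then have "P \<noteq> {}" using less.prems(4) by auto
    define p where "p = Max P"
    have p: "p \<in> P" "\<And>q. q \<in> P - {p} \<Longrightarrow> q < p"
      using \<open>P \<noteq> {}\<close> less.prems(2) by (auto simp: p_def le_neq_implies_less)
    have lt: "card (P - {p}) < card P" using p(1) less.prems(2) by (meson card_Diff1_less)
    have cP: "card (P - {p}) = card P - 1" using p(1) less.prems(2) by simp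
    have above: "b a - int q > b a0 - int p" if "a \<in> A" "q \<in> P - {p}" for a q
      using a0(2)[OF that(1)] p(2)[OF that(2)] by linarith
    show ?thesis
    proof (cases "b a0 - int p \<in> X")
      case True
      have "card (X - {b a0 - int p}) = card X - 1" "card X > 0"
        using True less.prems(3) by (auto simp: card_gt_0_iff)
      then have "card A + card (X - {b a0 - int p}) \<le> card (P - {p})"
        using less.prems(4) cP by linarith
      then obtain f where f: "inj_on f A" "f ` A \<subseteq> P - {p}" "inj_on (\<lambda>a. b a - int (f a)) A"
        "\<forall>a\<in>A. b a - int (f a) \<notin> X - {b a0 - int p}"
        using less.hyps[OF lt, of A "X - {b a0 - int p}"] less.prems(1-3) by (meson finite_Diff)
      have "b a - int (f a) \<notin> X" if "a \<in> A" for a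
      proof -
        have "f a \<in> P - {p}" using f(2) that by blast
        then have "b a - int (f a) \<noteq> b a0 - int p" using above[OF that] by fastforce
        then show ?thesis using f(4) that by blast
      qed
      then show ?thesis using f by blast
    next
      case False
      have "card (A - {a0}) + card X \<le> card (P - {p})"
        using less.prems(1,4) cP a0(1) \<open>card A > 0\<close> by simp
      then obtain f where f: "inj_on f (A - {a0})" "f ` (A - {a0}) \<subseteq> P - {p}"
        "inj_on (\<lambda>a. b a - int (f a)) (A - {a0})" "\<forall>a\<in>A - {a0}. b a - int (f a) \<notin> X"
        using less.hyps[OF lt, of "A - {a0}" X] less.prems(1-3) by (meson finite_Diff)
      let ?g = "f(a0 := p)"
      have ab: "f a \<noteq> p \<and> b a - int (f a) > b a0 - int p" if "a \<in> A - {a0}" for a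
        using above[of a "f a"] f(2) that by auto
      have "inj_on ?g A"
        using f(1) ab by (auto simp: inj_on_def)
      moreover have "?g ` A \<subseteq> P" using f(2) p(1) by auto
      moreover have "inj_on (\<lambda>a. b a - int (?g a)) A"
        using f(3) ab by (simp add: inj_on_def) (metis less_irrefl)
      moreover have "\<forall>a\<in>A. b a - int (?g a) \<notin> X" using f(4) False by auto
      ultimately show ?thesis by blast
    qed
  qed simp
qed

text \<open>The maximum of \<open>S\<close> is at least \<open>c + card S - 1\<close>, because
  \<open>S\<close> lies between \<open>c\<close> and it; induction removes the maximum. Applied to
  the labels at \<open>x\<close>, this shows how negative the sum there is.\<close>

lemma sum_distinct_ge:
  fixes S :: "nat set"
  assumes "finite S" "\<And>s. s \<in> S \<Longrightarrow> s \<ge> c"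
  shows "\<Sum>S \<ge> card S * c + card S * (card S - 1) div 2"
  using assms
proof (induction "card S" arbitrary: S)
  case (Suc n)
  define p where "p = Max S"
  have ne: "S \<noteq> {}" using Suc.hyps(2) by auto
  have p: "p \<in> S" using ne Suc.prems by (simp add: p_def)
  have c: "card (S - {p}) = n" using p Suc by simp
  have "S \<subseteq> {c..p}" using Suc.prems by (auto simp: p_def)
  then have "card S \<le> card {c..p}" by (rule card_mono[rotated]) simp
  then have "p \<ge> c + n" using Suc.hyps(2) by simp
  moreover have "\<Sum>(S - {p}) \<ge> n * c + n * (n - 1) div 2"
    using Suc.hyps(1)[of "S - {p}"] c Suc.prems by simp
  moreover have "\<Sum>S = p + \<Sum>(S - {p})" using p Suc.prems by (simp add: sum.remove)
  moreover have "(Suc n) * n div 2 = n + n * (n - 1) div 2"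
    by (cases n) (auto simp: algebra_simps)
  ultimately show ?case using Suc.hyps(2)[symmetric] by simp
qed simp

subsection \<open>Trail labellings\<close>

definition label :: "('a \<times> 'a) list \<Rightarrow> nat list \<Rightarrow> ('a \<times> 'a \<times> nat) list" where
  "label as ls = map2 (\<lambda>(u, w) l. (u, w, l)) as ls"

lemma label_simps [simp]:
  "label [] ls = []" "label as [] = []"
  "label ((u, w) # as) (l # ls) = (u, w, l) # label as ls"
  by (simp_all add: label_def)

lemma label_append:
  "length as = length ls \<Longrightarrow> label (as @ bs) (ls @ ms) = label as ls @ label bs ms"
  by (simp add: label_def)

lemma map_label:
  assumes "length as = length ls"
  shows "map (\<lambda>(u, v, l). {u, v}) (label as ls) = map (\<lambda>(u, v). {u, v}) as"
    and "map (\<lambda>(u, v, l). l) (label as ls) = ls"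
  using assms by (induction as ls rule: list_induct2) auto

lemma labelled_label:
  assumes "length as = length ls" "distinct (map (\<lambda>(u, v). {u, v}) as)" "distinct ls"
  shows "labelled (label as ls) ((\<lambda>(u, v). {u, v}) ` set as) (set ls)"
  unfolding labelled_def using map_label[OF assms(1)] assms(2,3) by (metis list.set_map)

fun arcs :: "'a list \<Rightarrow> ('a \<times> 'a) list" where
  "arcs (u # v # p) = (u, v) # arcs (v # p)"
| "arcs _ = []"

text \<open>A list rather than a set, so that its multiset detects repeated edges: a trail
  decomposition becomes an equality with \<open>mset_set F\<close>.\<close>

definition edges :: "'a list \<Rightarrow> 'a set list" where
  "edges p = map (\<lambda>(u, v). {u, v}) (arcs p)"

lemma edges_simps [simp]:
  "edges [] = []" "edges [u] = []" "edges (u # v # p) = {u, v} # edges (v # p)"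
  by (simp_all add: edges_def)

lemma edges_append: "edges (p @ v # q) = edges (p @ [v]) @ edges (v # q)"
proof (induction p)
  case (Cons u p)
  then show ?case by (cases p) auto
qed simp

lemma mset_edges_rev: "mset (edges (rev p)) = mset (edges p)"
proof (induction p)
  case (Cons u p)
  show ?case
  proof (cases p)
    case (Cons v q)
    have "edges (rev q @ [v, u]) = edges (rev q @ [v]) @ [{v, u}]"
      using edges_append[of "rev q" v "[u]"] by simp
    then show ?thesis using Cons.IH Cons by (simp add: insert_commute)
  qed simp
qed simp

lemma length_arcs: "length (arcs (u # p)) = length p"
  by (induction p arbitrary: u) auto

text \<open>A decomposition into the least number of trails has distinct starting vertices:
  of two trails with the same start, one could be reversed and continued by the other.\<close>
lemma trail_decomposition:
  assumes "finite F" "\<And>e. e \<in> F \<Longrightarrow> card e = 2"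
  obtains ts where "[] \<notin> set ts" "mset (concat (map edges ts)) = mset_set F" "distinct (map hd ts)"
proof -
  define P where "P ts \<longleftrightarrow> [] \<notin> set ts \<and> mset (concat (map edges ts)) = mset_set F" for ts
  \<comment> \<open>Some decomposition exists, since every edge is a trail by itself.\<close>
  have "\<exists>ts. P ts"
    unfolding P_def using assms
  proof (induction F rule: finite_induct)
    case empty
    then show ?case by (intro exI[of _ "[]"]) simp
  next
    case (insert e F)
    then obtain ts where ts: "[] \<notin> set ts" "mset (concat (map edges ts)) = mset_set F" by auto
    obtain u v where "e = {u, v}" using insert.prems[of e] by (auto simp: card_2_iff)
    then show ?case using ts insert.hyps by (intro exI[of _ "[u, v] # ts"]) simp
  qed
  then obtain ts where ts: "P ts" "\<And>ts'. P ts' \<Longrightarrow> length ts \<le> length ts'"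
    by (metis ex_has_least_nat)
  have "distinct (map hd ts)"
  proof (rule ccontr)
    assume "\<not> distinct (map hd ts)"
    then obtain xs ys zs y where "map hd ts = xs @ [y] @ ys @ [y] @ zs"
      using not_distinct_decomp by blast
    then obtain as ts' where ts': "ts = as @ ts'" "map hd ts' = y # (ys @ y # zs)"
      by (auto simp: map_eq_append_conv)
    then obtain p ts'' where ts'': "ts' = p # ts''" "hd p = y" "map hd ts'' = ys @ y # zs"
      by (auto simp: map_eq_Cons_conv)
    then obtain bs ts3 where ts3: "ts'' = bs @ ts3" "map hd ts3 = y # zs"
      by (auto simp: map_eq_append_conv)
    then obtain q cs where "ts3 = q # cs" "hd q = y"
      by (auto simp: map_eq_Cons_conv)
    then have decomp: "ts = as @ [p] @ bs @ [q] @ cs" "hd p = y" "hd q = y"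
      using ts' ts'' ts3 by simp_all
    then obtain p' q' where p: "p = y # p'" and q: "q = y # q'"
      using ts(1) by (cases p; cases q) (auto simp: P_def)
    have "mset (edges (rev p' @ y # q')) = mset (edges p) + mset (edges q)"
      using edges_append[of "rev p'" y q'] mset_edges_rev[of p] p q by simp
    then have "P ((rev p' @ y # q') # as @ bs @ cs)"
      using ts(1) decomp by (auto simp: P_def ac_simps)
    then show False using ts(2) decomp(1) by fastforce
  qed
  then show ?thesis using that ts(1) unfolding P_def by blast
qed

text \<open>Labels decrease along the trail, so whenever a vertex is entered and left again, the
  entering label outweighs the leaving one. Only the first arc, at the start \<open>u\<close>, is
  not compensated.\<close>

lemma net_trail:
  assumes "length ls = length p" "sorted_wrt (>) ls" "\<And>l. l \<in> set ls \<Longrightarrow> l \<le> M"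
  shows "net (label (arcs (u # p)) ls) v \<ge> (if v = u then - int M else 0)"
  using assms
proof (induction p arbitrary: u ls M)
  case (Cons w p)
  obtain l ms where ls: "ls = l # ms" using Cons.prems(1) by (cases ls) auto
  have "net (label (arcs (w # p)) ms) v \<ge> (if v = w then - int l else 0)"
    using Cons.prems(1,2) ls by (intro Cons.IH) (auto intro: less_imp_le)
  then show ?case using Cons.prems(3)[of l] ls by (auto split: if_splits)
qed simp

text \<open>The trails receive consecutive blocks of \<open>ls\<close>. A vertex starts at most one
  of them, so the loss of up to \<open>M\<close> is incurred at most once.\<close>

lemma net_trails:
  assumes "[] \<notin> set ts" "distinct (map hd ts)" "length ls = length (concat (map arcs ts))"
    "sorted_wrt (>) ls" "\<And>l. l \<in> set ls \<Longrightarrow> l \<le> M"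
  shows "net (label (concat (map arcs ts)) ls) v \<ge> (if v \<in> hd ` set ts then - int M else 0)"
  using assms
proof (induction ts arbitrary: ls)
  case (Cons p ts)
  obtain u q where p: "p = u # q" using Cons.prems(1) by (cases p) auto
  define n where "n = length (arcs p)"
  have ls: "ls = take n ls @ drop n ls" by simp
  have n: "length (take n ls) = n" using Cons.prems(3) by (simp add: n_def)
  have sub: "set (take n ls) \<subseteq> set ls" "set (drop n ls) \<subseteq> set ls"
    by (simp_all add: set_take_subset set_drop_subset)
  have "net (label (arcs p) (take n ls)) v \<ge> (if v = u then - int M else 0)"
    unfolding p using n Cons.prems(4,5) sub(1)
    by (intro net_trail) (auto simp: n_def p length_arcs)
  moreover have "net (label (concat (map arcs ts)) (drop n ls)) v \<ge> (if v \<in> hd ` set ts then - int M else 0)"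
    using Cons.prems sub(2) by (intro Cons.IH) (auto simp: n_def)
  moreover have "label (concat (map arcs (p # ts))) ls =
      label (arcs p) (take n ls) @ label (concat (map arcs ts)) (drop n ls)"
    using label_append[of "arcs p" "take n ls" "concat (map arcs ts)" "drop n ls"] n
    by (simp add: n_def)
  moreover have "u \<notin> hd ` set ts" using Cons.prems(2) p by simp
  ultimately show ?case using p by (auto split: if_splits)
qed simp

text \<open>Used for the edges inside \<open>N\<close>: however large the degrees are, one label
  bounds the loss at every vertex. The trails of \<open>trail_decomposition\<close> are labelled
  with the elements of \<open>L\<close> in decreasing order.\<close>

lemma balanced_labelling:
  assumes F: "finite F" "\<And>e. e \<in> F \<Longrightarrow> card e = 2"
    and L: "finite L" "card L = card F" "\<And>l. l \<in> L \<Longrightarrow> l \<le> M"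
  obtains xs where "labelled xs F L" "\<And>v. net xs v \<ge> - int M"
proof -
  obtain ts where ts: "[] \<notin> set ts" "mset (concat (map edges ts)) = mset_set F" "distinct (map hd ts)"
    using trail_decomposition[OF F] by metis
  let ?as = "concat (map arcs ts)"
  define ls where "ls = rev (sorted_list_of_set L)"
  have ls: "set ls = L" "distinct ls" "sorted_wrt (>) ls" "length ls = card F"
    using L by (simp_all add: ls_def sorted_wrt_rev)
  have "map (\<lambda>(u, v). {u, v}) ?as = concat (map edges ts)"
    by (simp add: map_concat edges_def[abs_def] comp_def)
  then have as: "mset (map (\<lambda>(u, v). {u, v}) ?as) = mset_set F"
    using ts(2) by simp
  have len: "length ?as = length ls"
    using arg_cong[OF as, of size] ls(4) by simp
  have set_as: "set (map (\<lambda>(u, v). {u, v}) ?as) = F"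
    using arg_cong[OF as, of set_mset] F(1) by simp
  moreover have "distinct (map (\<lambda>(u, v). {u, v}) ?as)"
    by (rule card_distinct) (simp only: set_as, simp add: len ls(4))
  ultimately have "labelled (label ?as ls) F L"
    using labelled_label[OF len _ ls(2)] ls(1) by simp
  moreover have "net (label ?as ls) v \<ge> - int M" for v
    using net_trails[OF ts(1,3) len[symmetric] ls(3), of M v] L(3) ls(1) by (auto split: if_splits)
  ultimately show ?thesis using that by blast
qed

subsection \<open>Graphs on at most four vertices\<close>

definition pairs :: "(nat \<times> nat) list" where
  "pairs = [(0,1), (0,2), (1,2), (0,3), (1,3), (2,3)]"

text \<open>The graphs on at most four vertices are coded as graphs on \<open>{0, 1, 2, 3}\<close>, where the vertices
  \<open>\<ge> \<beta>\<close> are those without a neighbour in \<open>N\<close>; rootedness says that no set of such vertices is closed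
  under adjacency.\<close>
definition rooted :: "(nat \<times> nat) list \<Rightarrow> nat \<Rightarrow> bool" where
  "rooted S \<beta> \<longleftrightarrow> (\<forall>X\<in>set (subseqs [\<beta>..<4]). X \<noteq> [] \<longrightarrow> (\<exists>(i, j)\<in>set S. (i \<in> set X) \<noteq> (j \<in> set X)))"

definition restrict :: "(nat \<times> nat) list \<Rightarrow> (nat \<times> nat) list \<Rightarrow> (nat \<times> nat) list" where
  "restrict T S = filter (\<lambda>(i, j). (i, j) \<in> set S \<or> (j, i) \<in> set S) T"

text \<open>A template is an ordering and an orientation of all six pairs; a graph inherits both from it.
  The six templates were found by a computer search.\<close>
definition templates :: "(nat \<times> nat) list list" where
  "templates = [
    [(0,3), (3,1), (2,0), (2,1), (3,2), (1,0)],
    [(2,3), (1,2), (1,0), (3,1), (3,0), (2,0)],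
    [(1,2), (0,2), (3,1), (2,3), (1,0), (3,0)],
    [(3,2), (0,1), (2,1), (3,0), (1,3), (2,0)],
    [(2,3), (2,1), (1,3), (0,2), (3,0), (1,0)],
    [(0,2), (1,0), (1,3), (3,2), (2,1), (3,0)]]"

text \<open>The \<open>r\<close> arcs get the labels \<open>1, \<dots>, r\<close>, which is enough if no smaller label than \<open>r + 1\<close> is left
  for the other edges.\<close>
definition good_tight :: "(nat \<times> nat) list \<Rightarrow> nat \<Rightarrow> bool" where
  "good_tight as \<beta> \<longleftrightarrow> (let r = length as; s = net (label as [1..<r+1]) in
     distinct (map s [\<beta>..<4]) \<and> (\<forall>i\<in>set [\<beta>..<4]. s i \<le> int r) \<and> (\<forall>i\<in>set [0..<\<beta>]. s i \<le> 2 * int r + 1))"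

text \<open>The \<open>r\<close> arcs get the labels \<open>1, \<dots>, r - 1\<close> and an unspecified \<open>t \<ge> r + 1\<close>, so that vertex \<open>i\<close> has
  sum \<open>x i + y i * t\<close>. The bounds at \<open>t = r + 1\<close> and the signs of the slopes give the bounds for all \<open>t\<close>.\<close>
definition good_loose :: "(nat \<times> nat) list \<Rightarrow> nat \<Rightarrow> bool" where
  "good_loose as \<beta> \<longleftrightarrow> (let r = length as; t = int r + 1;
       x = net (label as ([1..<r] @ [0]));
       y = net (label as (replicate (r - 1) 0 @ [1])) in
     (\<forall>i\<in>set [\<beta>..<4]. y i \<le> 0 \<and> x i + y i * t \<le> 1 \<and>
        (\<forall>j\<in>set [\<beta>..<i]. if y i = y j then x i \<noteq> x j
            else if y i < y j then x i + y i * t < x j + y j * t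
            else x j + y j * t < x i + y i * t)) \<and>
     (\<forall>i\<in>set [0..<\<beta>]. y i \<le> 1 \<and> x i + y i * t \<le> t + 2))"

text \<open>Checked by evaluation over all 64 subsets of the six pairs and all five values of
  \<open>\<beta>\<close>. The tight and the loose condition may be met by different templates;
  graphs without edges are treated separately.\<close>

lemma templates_suffice:
  "\<forall>S\<in>set (subseqs pairs). \<forall>\<beta>\<in>set [0..<5]. S \<noteq> [] \<longrightarrow> rooted S \<beta> \<longrightarrow>
     (\<exists>T\<in>set templates. good_tight (restrict T S) \<beta>) \<and>
     (\<exists>T\<in>set templates. good_loose (restrict T S) \<beta>)"
  by code_simp


text \<open>Ensures that restricting a template to a graph lists each edge of the graph exactly
  once, in one of its two directions.\<close>

lemma templates_orient_pairs:
  "\<forall>T\<in>set templates. distinct (map (\<lambda>(i, j). (min i j, max i j)) T) \<and>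
     set (map (\<lambda>(i, j). (min i j, max i j)) T) = set pairs"
  by code_simp

section \<open>Transport of labellings from \<open>{0, 1, 2, 3}\<close> to an arbitrary small
  graph\<close>

lemma filter_in_subseqs: "filter Q xs \<in> set (subseqs xs)"
  by (induction xs) (auto simp: Let_def)

lemma mem_pairs: "(i, j) \<in> set pairs \<longleftrightarrow> i < j \<and> j < 4"
  by (auto simp: pairs_def)

lemma net_label_map:
  assumes "inj_on f D" "\<And>i j. (i, j) \<in> set as \<Longrightarrow> i \<in> D \<and> j \<in> D" "k \<in> D"
  shows "net (label (map (\<lambda>(i, j). (f i, f j)) as) ls) (f k) = net (label as ls) k"
  using assms(2)
proof (induction as arbitrary: ls)
  case (Cons a as)
  obtain i j where a: "a = (i, j)" by (cases a)
  show ?case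
  proof (cases ls)
    case (Cons l ms)
    have "i \<in> D" "j \<in> D" using Cons.prems[of i j] a by auto
    then have "f i = f k \<longleftrightarrow> i = k" "f j = f k \<longleftrightarrow> j = k"
      using assms(1,3) by (auto dest: inj_onD)
    moreover have "net (label (map (\<lambda>(i, j). (f i, f j)) as) ms) (f k) = net (label as ms) k"
      by (rule Cons.IH) (meson Cons.prems list.set_intros(2))
    ultimately show ?thesis using Cons a by simp
  qed simp
qed simp

text \<open>Sums are affine in the label of the last arc. Label \<open>0\<close> there gives the
  constant term, and label \<open>1\<close> there with \<open>0\<close> elsewhere gives the
  slope.\<close>

lemma net_label_last:
  assumes "length as = Suc (length ls)"
  shows "net (label as (ls @ [t])) v =
    net (label as (ls @ [0])) v + net (label as (replicate (length ls) 0 @ [1])) v * int t"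
  using assms
proof (induction ls arbitrary: as)
  case Nil
  then obtain u w where "as = [(u, w)]" by (cases as) auto
  then show ?case by simp
next
  case (Cons l ls)
  then obtain u w bs where "as = (u, w) # bs" "length bs = Suc (length ls)" by (cases as) auto
  then show ?case using Cons.IH[of bs] by simp
qed

text \<open>Here \<open>c\<close> is the number of labels available below the ones reserved for the edges at \<open>x\<close>, plus one.
  The unused labels stay below \<open>c - u\<close>, which keeps the sums in \<open>N\<close> above \<open>u\<close>; the vertices in \<open>A\<close>
  have an outgoing edge with a label \<open>\<ge> c\<close> still to come.\<close>
lemma small_graph_labelling:
  assumes W: "finite W" "card W \<le> 4" "A \<subseteq> W"
    and F: "\<And>e. e \<in> F \<Longrightarrow> e \<subseteq> W \<and> card e = 2"
    and reach: "\<And>X. X \<subseteq> W - A \<Longrightarrow> X \<noteq> {} \<Longrightarrow> \<exists>e\<in>F. e \<inter> X \<noteq> {} \<and> \<not> e \<subseteq> X"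
    and c: "card F < c"
  obtains xs L u where "labelled xs F L" "L \<subseteq> {1..<c}" "u < c"
    "\<And>l. l \<in> {1..<c} - L \<Longrightarrow> l + u < c" "inj_on (net xs) (W - A)"
    "\<And>b. b \<in> W - A \<Longrightarrow> net xs b \<le> int u" "\<And>a. a \<in> A \<Longrightarrow> net xs a \<le> int (c + u)"
proof (cases "F = {}")
  case True
  then have "W - A = {}" using reach[of "W - A"] by auto
  then have "inj_on (net []) (W - A)" by (metis inj_on_empty)
  moreover have "labelled [] F {}" using True by (simp add: labelled_def)
  ultimately show ?thesis using that[of "[]" "{}" 0] c \<open>W - A = {}\<close> by simp
next
  case False
  \<comment> \<open>Indices in \<open>{d..<\<beta>}\<close> code \<open>A\<close> and those in
    \<open>{\<beta>..<4}\<close> code \<open>W - A\<close>. Indices below \<open>d\<close> stand for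
    no vertex and pad the graph to four vertices as isolated ones.\<close>
  define d \<beta> where "d = 4 - card W" and "\<beta> = 4 - card (W - A)"
  have fA: "finite A" using W finite_subset by blast
  have cWA: "card (W - A) = card W - card A" "card A \<le> card W"
    using W fA by (simp_all add: card_Diff_subset card_mono)
  have d\<beta>: "d \<le> \<beta>" "\<beta> \<le> 4" using cWA by (simp_all add: d_def \<beta>_def)
  obtain g where g: "bij_betw g {d..<\<beta>} A"
    using finite_same_card_bij[of "{d..<\<beta>}" A] fA cWA W(2) by (auto simp: d_def \<beta>_def)
  obtain h where h: "bij_betw h {\<beta>..<4} (W - A)"
    using finite_same_card_bij[of "{\<beta>..<4}" "W - A"] W(1) cWA W(2) by (auto simp: \<beta>_def)
  define f where "f i = (if i < \<beta> then g i else h i)" for i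
  have fA': "bij_betw f {d..<\<beta>} A"
    using g by (rule bij_betw_cong[THEN iffD1, rotated]) (simp add: f_def)
  have fB: "bij_betw f {\<beta>..<4} (W - A)"
    using h by (rule bij_betw_cong[THEN iffD1, rotated]) (simp add: f_def)
  have imA: "A = f ` {d..<\<beta>}" and imB: "W - A = f ` {\<beta>..<4}"
    using fA' fB by (simp_all add: bij_betw_def)
  have "bij_betw f ({d..<\<beta>} \<union> {\<beta>..<4}) (A \<union> (W - A))"
    using fA' fB by (rule bij_betw_combine) auto
  then have f: "inj_on f {d..<4}" "f ` {d..<4} = W"
    using d\<beta> W(3) by (simp_all add: bij_betw_def ivl_disj_un_two(3) Un_absorb1)
  define S where "S = filter (\<lambda>(i, j). d \<le> i \<and> {f i, f j} \<in> F) pairs"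
  have S_sub: "S \<in> set (subseqs pairs)" by (simp add: S_def filter_in_subseqs)
  have S_mem: "(i, j) \<in> set S \<longleftrightarrow> d \<le> i \<and> i < j \<and> j < 4 \<and> {f i, f j} \<in> F" for i j
    by (auto simp: S_def mem_pairs)
  have edge: "\<exists>(i, j)\<in>set S. e = {f i, f j}" if eF: "e \<in> F" for e
  proof -
    obtain u v where e: "e = {u, v}" "u \<noteq> v" "u \<in> W" "v \<in> W"
      using F[OF eF] by (auto simp: card_2_iff)
    then obtain i j where ij: "u = f i" "v = f j" "i \<in> {d..<4}" "j \<in> {d..<4}"
      using f(2) by blast
    then have "i \<noteq> j" using e by auto
    then show ?thesis using eF e ij S_mem[of i j] S_mem[of j i]
      by (cases "i < j") (auto simp: insert_commute)
  qed
  have "S \<noteq> []" using edge False by fastforce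
  have "rooted S \<beta>"
    unfolding rooted_def
  proof (intro ballI impI)
    fix X assume X: "X \<in> set (subseqs [\<beta>..<4])" "X \<noteq> []"
    have Xsub: "set X \<subseteq> {\<beta>..<4}"
      using X(1) subseqs_powset[of "[\<beta>..<4]"] by (metis PowD imageI set_upt)
    then have "f ` set X \<subseteq> W - A" using fB by (auto simp: bij_betw_def)
    then obtain e where e: "e \<in> F" "e \<inter> f ` set X \<noteq> {}" "\<not> e \<subseteq> f ` set X"
      using reach[of "f ` set X"] X(2) by auto
    obtain i j where ij: "(i, j) \<in> set S" "e = {f i, f j}" using edge[OF e(1)] by auto
    have "f k \<in> f ` set X \<longleftrightarrow> k \<in> set X" if "k \<in> {d..<4}" for k
      using that Xsub d\<beta>(1) inj_on_image_mem_iff[OF f(1), of k "set X"] by fastforce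
    then have "(i \<in> set X) \<noteq> (j \<in> set X)"
      using e ij S_mem[of i j] by auto
    then show "\<exists>(i, j)\<in>set S. (i \<in> set X) \<noteq> (j \<in> set X)" using ij(1) by blast
  qed
  have "\<beta> \<in> set [0..<5]" using d\<beta>(2) by simp
  note good = templates_suffice[rule_format, OF S_sub this \<open>S \<noteq> []\<close> \<open>rooted S \<beta>\<close>]
  \<comment> \<open>Carrying a restricted template over along \<open>f\<close> gives an orientation
    of \<open>F\<close> with the same sums, for any choice of labels.\<close>
  have transport: "length (restrict T S) = card F \<and>
      (\<forall>ls. distinct ls \<and> length ls = card F \<longrightarrow>
        labelled (label (map (\<lambda>(i, j). (f i, f j)) (restrict T S)) ls) F (set ls)) \<and>
      (\<forall>ls. \<forall>k\<in>{d..<4}. net (label (map (\<lambda>(i, j). (f i, f j)) (restrict T S)) ls) (f k) =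
          net (label (restrict T S) ls) k)"
    if T: "T \<in> set templates" for T
  proof -
    let ?as = "restrict T S"
    have mem: "(i, j) \<in> set ?as \<longleftrightarrow> (i, j) \<in> set T \<and> ((i, j) \<in> set S \<or> (j, i) \<in> set S)" for i j
      by (auto simp: restrict_def)
    have D: "i \<in> {d..<4} \<and> j \<in> {d..<4}" if "(i, j) \<in> set ?as" for i j
      using that mem S_mem[of i j] S_mem[of j i] by auto
    have cover: "(i, j) \<in> set T \<or> (j, i) \<in> set T" if "(i, j) \<in> set S" for i j
    proof -
      have "(i, j) \<in> set pairs" using that by (simp add: S_def)
      moreover have "(\<lambda>(i, j). (min i j, max i j)) ` set T = set pairs"
        using bspec[OF templates_orient_pairs T] by simp
      ultimately obtain a where "a \<in> set T" "(i, j) = (case a of (i, j) \<Rightarrow> (min i j, max i j))"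
        by blast
      then show ?thesis by (cases "fst a \<le> snd a") (auto split: prod.splits)
    qed
    have set: "(\<lambda>(u, v). {u, v}) ` set (map (\<lambda>(i, j). (f i, f j)) ?as) = F" (is "?l = F")
    proof
      show "?l \<subseteq> F"
      proof
        fix e assume "e \<in> ?l"
        then obtain i j where "(i, j) \<in> set ?as" "e = {f i, f j}" by auto
        then show "e \<in> F" using mem[of i j] S_mem[of i j] S_mem[of j i] by (auto simp: insert_commute)
      qed
      show "F \<subseteq> ?l"
      proof
        fix e assume "e \<in> F"
        then obtain i j where ij: "(i, j) \<in> set S" "e = {f i, f j}" using edge by blast
        then have "(i, j) \<in> set ?as \<or> (j, i) \<in> set ?as" using mem cover by blast
        then show "e \<in> ?l"
        proof
          assume "(i, j) \<in> set ?as"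
          then show ?thesis using ij(2) by force
        next
          assume "(j, i) \<in> set ?as"
          then show ?thesis using ij(2) by (force simp: insert_commute)
        qed
      qed
    qed
    have "inj_on (\<lambda>(i, j). {f i, f j}) (set ?as)"
    proof (rule inj_onI, clarify)
      fix i j i' j' assume *: "(i, j) \<in> set ?as" "(i', j') \<in> set ?as" "{f i, f j} = {f i', f j'}"
      have "{i, j} = {i', j'}"
        using * D[OF *(1)] D[OF *(2)] f(1) by (auto simp: doubleton_eq_iff dest: inj_onD)
      then have eq: "(min i j, max i j) = (min i' j', max i' j')"
        by (auto simp: doubleton_eq_iff min_def max_def)
      have inT: "(i, j) \<in> set T" "(i', j') \<in> set T" using * mem by auto
      have "inj_on (\<lambda>(i, j). (min i j, max i j)) (set T)"
        using templates_orient_pairs T by (auto simp: distinct_map)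
      from inj_onD[OF this _ inT] eq show "i = i' \<and> j = j'" by simp
    qed
    moreover have "distinct ?as"
      using templates_orient_pairs T by (auto simp: restrict_def distinct_map)
    ultimately have "distinct (map (\<lambda>(i, j). {f i, f j}) ?as)"
      by (simp add: distinct_map)
    moreover have "map (\<lambda>(u, v). {u, v}) (map (\<lambda>(i, j). (f i, f j)) ?as) = map (\<lambda>(i, j). {f i, f j}) ?as"
      by auto
    ultimately have dist: "distinct (map (\<lambda>(u, v). {u, v}) (map (\<lambda>(i, j). (f i, f j)) ?as))"
      by (simp only:)
    have "card F = length ?as"
      using distinct_card[OF dist] set by (metis length_map list.set_map)
    moreover have "labelled (label (map (\<lambda>(i, j). (f i, f j)) ?as) ls) F (set ls)"
      if "distinct ls" "length ls = card F" for ls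
      using labelled_label[of "map (\<lambda>(i, j). (f i, f j)) ?as" ls] dist set that calculation by simp
    moreover have "net (label (map (\<lambda>(i, j). (f i, f j)) ?as) ls) (f k) = net (label ?as ls) k"
      if "k \<in> {d..<4}" for ls k
      using net_label_map[OF f(1) D that] .
    ultimately show ?thesis by simp
  qed
  have r: "card F > 0"
    using False W(1) F by (metis card_gt_0_iff finite_Pow_iff finite_subset Pow_iff subsetI)
  show ?thesis
  proof (cases "c = card F + 1")
    case True
    obtain T where T: "T \<in> set templates" "good_tight (restrict T S) \<beta>" using good by blast
    let ?as = "map (\<lambda>(i, j). (f i, f j)) (restrict T S)"
    define xs where "xs = label ?as [1..<card F + 1]"
    note tr = transport[OF T(1)]
    have net: "net xs (f k) = net (label (restrict T S) [1..<card F + 1]) k" if "k \<in> {d..<4}" for k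
      using tr that by (simp add: xs_def)
    have good: "distinct (map (net (label (restrict T S) [1..<card F + 1])) [\<beta>..<4])"
      "\<And>i. i \<in> {\<beta>..<4} \<Longrightarrow> net (label (restrict T S) [1..<card F + 1]) i \<le> int (card F)"
      "\<And>i. i < \<beta> \<Longrightarrow> net (label (restrict T S) [1..<card F + 1]) i \<le> 2 * int (card F) + 1"
      using T(2) tr by (auto simp: good_tight_def Let_def)
    have "labelled xs F {1..card F}"
    proof -
      have "labelled xs F (set [1..<card F + 1])"
        unfolding xs_def using tr by (simp del: upt_Suc set_upt)
      moreover have "set [1..<card F + 1] = {1..card F}" by auto
      ultimately show ?thesis by simp
    qed
    moreover have "inj_on (net xs) (W - A)"
    proof -
      have "inj_on (net xs \<circ> f) {\<beta>..<4} \<longleftrightarrow> inj_on (net (label (restrict T S) [1..<card F + 1])) {\<beta>..<4}"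
        by (rule inj_on_cong) (use net d\<beta>(1) in auto)
      then have "inj_on (net xs \<circ> f) {\<beta>..<4}" using good(1) by (simp add: distinct_map)
      then show ?thesis using fB by (metis bij_betw_def inj_on_imageI)
    qed
    moreover have "net xs b \<le> int (card F)" if "b \<in> W - A" for b
    proof -
      obtain k where "k \<in> {\<beta>..<4}" "b = f k" using \<open>b \<in> W - A\<close>[unfolded imB] by blast
      then show ?thesis using good(2)[of k] net[of k] d\<beta>(1) by simp
    qed
    moreover have "net xs a \<le> int (c + card F)" if "a \<in> A" for a
    proof -
      obtain k where "k \<in> {d..<\<beta>}" "a = f k" using \<open>a \<in> A\<close>[unfolded imA] by blast
      then show ?thesis using good(3)[of k] net[of k] d\<beta> True by auto
    qed
    moreover have "{1..card F} \<subseteq> {1..<c}" using True by auto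
    moreover have "l + card F < c" if "l \<in> {1..<c} - {1..card F}" for l using that True by auto
    ultimately show ?thesis using that[of xs "{1..card F}" "card F"] c by blast
  next
    case False
    define t where "t = c - 1"
    have t: "t \<ge> card F + 1" "c = t + 1" using False c by (auto simp: t_def)
    obtain T where T: "T \<in> set templates" "good_loose (restrict T S) \<beta>" using good by blast
    let ?as = "map (\<lambda>(i, j). (f i, f j)) (restrict T S)"
    define ls where "ls = [1..<card F]"
    define xs where "xs = label ?as (ls @ [t])"
    note tr = transport[OF T(1)]
    define x y where "x = net (label (restrict T S) (ls @ [0]))"
      and "y = net (label (restrict T S) (replicate (card F - 1) 0 @ [1]))"
    define t0 where "t0 = int (card F) + 1"
    have net: "net xs (f k) = x k + y k * int t" if "k \<in> {d..<4}" for k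
      using tr that net_label_last[of "restrict T S" ls t k] r by (simp add: xs_def x_def y_def ls_def)
    have goodB: "y i \<le> 0" "x i + y i * t0 \<le> 1"
        "\<And>j. \<beta> \<le> j \<Longrightarrow> j < i \<Longrightarrow> if y i = y j then x i \<noteq> x j
            else if y i < y j then x i + y i * t0 < x j + y j * t0
            else x j + y j * t0 < x i + y i * t0" if "i \<in> {\<beta>..<4}" for i
      using T(2) tr that by (auto simp: good_loose_def Let_def x_def y_def ls_def t0_def)
    have goodA: "y i \<le> 1" "x i + y i * t0 \<le> t0 + 2" if "i < \<beta>" for i
      using T(2) tr that by (auto simp: good_loose_def Let_def x_def y_def ls_def t0_def)
    define s where "s = int t - t0"
    have s: "s \<ge> 0" "int t = t0 + s" using t by (auto simp: s_def t0_def)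
    have shift: "x i + y i * int t = x i + y i * t0 + y i * s" for i
      by (simp add: s(2) algebra_simps)
    \<comment> \<open>Two lines of different slope are ordered at \<open>t0\<close> so that the
      steeper one is already above; they cannot meet for larger \<open>t\<close>.\<close>
    have neq: "x i + y i * int t \<noteq> x j + y j * int t"
      if ij: "i \<in> {\<beta>..<4}" "\<beta> \<le> j" "j < i" for i j
    proof -
      consider "y i = y j" "x i \<noteq> x j" | "y i < y j" "x i + y i * t0 < x j + y j * t0"
        | "y j < y i" "x j + y j * t0 < x i + y i * t0"
        using goodB(3)[OF ij] by (auto split: if_splits)
      then show ?thesis
      proof cases
        case 2
        then have "y i * s \<le> y j * s" using s(1) by (simp add: mult_right_mono)
        then show ?thesis using 2 shift by simp
      next
        case 3
        then have "y j * s \<le> y i * s" using s(1) by (simp add: mult_right_mono)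
        then show ?thesis using 3 shift by simp
      qed simp
    qed
    have "labelled xs F (set (ls @ [t]))"
    proof -
      have "distinct (ls @ [t]) \<and> length (ls @ [t]) = card F" using r t by (simp add: ls_def)
      then show ?thesis using tr unfolding xs_def by blast
    qed
    moreover have "set (ls @ [t]) \<subseteq> {1..<c}" using t r by (auto simp: ls_def)
    moreover have "l + 1 < c" if "l \<in> {1..<c} - set (ls @ [t])" for l using that t by auto
    moreover have "inj_on (net xs) (W - A)"
    proof -
      have "inj_on (net xs \<circ> f) {\<beta>..<4}"
      proof (rule inj_onI, rule ccontr)
        fix i j assume ij: "i \<in> {\<beta>..<4}" "j \<in> {\<beta>..<4}" "(net xs \<circ> f) i = (net xs \<circ> f) j" "i \<noteq> j"
        then show False using neq[of i j] neq[of j i] net[of i] net[of j] d\<beta>(1)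
          by (cases "i < j") auto
      qed
      then show ?thesis using fB by (metis bij_betw_def inj_on_imageI)
    qed
    moreover have "net xs b \<le> int 1" if "b \<in> W - A" for b
    proof -
      obtain k where k: "k \<in> {\<beta>..<4}" "b = f k" using \<open>b \<in> W - A\<close>[unfolded imB] by blast
      have "y k * s \<le> 0" using goodB(1)[OF k(1)] s(1) by (simp add: mult_nonpos_nonneg)
      then show ?thesis using goodB(2)[OF k(1)] net[of k] shift[of k] k d\<beta>(1) by auto
    qed
    moreover have "net xs a \<le> int (c + 1)" if "a \<in> A" for a
    proof -
      obtain k where k: "k \<in> {d..<\<beta>}" "a = f k" using \<open>a \<in> A\<close>[unfolded imA] by blast
      \<comment> \<open>With slope at most 1, the bound \<open>t0 + 2\<close> grows to at most
        \<open>t0 + 2 + s\<close>, which is \<open>c + 1\<close>.\<close>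
      have "y k * s \<le> 1 * s" using goodA(1)[of k] k(1) s(1) by (intro mult_right_mono) auto
      then show ?thesis using goodA(2)[of k] net[of k] shift[of k] k d\<beta> s(2) t(2) by auto
    qed
    moreover have "1 < c" using t r by simp
    ultimately show ?thesis using that[of xs "set (ls @ [t])" 1] by blast
  qed
qed

subsection \<open>Graphs with at most four non-neighbours of a vertex\<close>

lemma labelled_map:
  assumes "distinct as" "inj_on (\<lambda>a. {s a, t a}) (set as)" "inj_on f (set as)"
  shows "labelled (map (\<lambda>a. (s a, t a, f a)) as) ((\<lambda>a. {s a, t a}) ` set as) (f ` set as)"
  using assms by (simp add: labelled_def distinct_map comp_def image_image)

lemma net_map:
  assumes "distinct as"
  shows "net (map (\<lambda>a. (s a, t a, f a)) as) v =
    (\<Sum>a\<in>set as. (if t a = v then int (f a) else 0) - (if s a = v then int (f a) else 0))"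
  using assms by (simp add: net_def sum_list_distinct_conv_sum_set comp_def)

lemma card_labelled:
  assumes "labelled xs F L" shows "finite L" "card L = card F"
proof -
  have "F = set (map (\<lambda>(u, v, l). {u, v}) xs)" "L = set (map (\<lambda>(u, v, l). l) xs)"
    "distinct (map (\<lambda>(u, v, l). {u, v}) xs)" "distinct (map (\<lambda>(u, v, l). l) xs)"
    using assms by (simp_all add: labelled_def)
  then show "finite L" "card L = card F" by (simp, metis distinct_card length_map)
qed

lemma rtrancl_exit:
  assumes "(b, x) \<in> R\<^sup>*" "b \<in> X" "x \<notin> X"
  obtains y z where "y \<in> X" "z \<notin> X" "(y, z) \<in> R"
  using assms by (induction rule: rtrancl_induct) blast+

text \<open>The hypotheses on \<open>W\<close> leave out maximum degree two with three or four non-neighbours: there, the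
  sum at \<open>x\<close> need not be the smallest one.\<close>
lemma antimagic_few_non_neighbours:
  assumes G: "simple_graph V E" and conn: "connected_graph V E" and xV: "x \<in> V"
    and N_def: "N = {v. {x, v} \<in> E}" and deg: "\<And>v. v \<in> V \<Longrightarrow> degree E v \<le> card N"
    and W_def: "W = V - insert x N" and k: "card W \<le> 4" "card W \<le> 2 \<or> 3 \<le> card N"
  shows "has_antimagic_orientation V E"
proof -
  have finV: "finite V" and EV: "\<And>e. e \<in> E \<Longrightarrow> e \<subseteq> V \<and> card e = 2"
    using G by (auto simp: simple_graph_def)
  have "E \<subseteq> Pow V" using EV by auto
  then have finE: "finite E" using finV finite_subset by blast
  have xN: "x \<notin> N" using EV[of "{x, x}"] by (auto simp: N_def)
  have NV: "N \<subseteq> V" using EV by (auto simp: N_def)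
  have finN: "finite N" and finW: "finite W" using NV finV finite_subset by (auto simp: W_def)
  have V: "V = insert x (N \<union> W)" and disj: "x \<notin> W" "N \<inter> W = {}" using NV xV by (auto simp: W_def)
  define A where "A = {w \<in> W. \<exists>v\<in>N. {w, v} \<in> E}"
  have AW: "A \<subseteq> W" by (auto simp: A_def)
  have finA: "finite A" using AW finW finite_subset by blast
  have "\<forall>a\<in>A. \<exists>v. v \<in> N \<and> {a, v} \<in> E" by (auto simp: A_def)
  from bchoice[OF this] obtain par where "\<forall>a\<in>A. par a \<in> N \<and> {a, par a} \<in> E" by blast
  note par = bspec[OF this]
  \<comment> \<open>\<open>EP\<close> consists of the picked edges and \<open>ES\<close> of the
    edges at \<open>x\<close>. What remains for \<open>Q\<close> are the other edges between
    \<open>A\<close> and \<open>N\<close>.\<close>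
  define F H EP ES where "F = {e \<in> E. e \<subseteq> W}" and "H = {e \<in> E. e \<subseteq> N}"
    and "EP = (\<lambda>a. {a, par a}) ` A" and "ES = (\<lambda>v. {x, v}) ` N"
  define Q where "Q = E - (F \<union> H \<union> EP \<union> ES)"
  have sub: "F \<subseteq> E" "H \<subseteq> E" "EP \<subseteq> E" "ES \<subseteq> E" "Q \<subseteq> E"
    using par by (auto simp: F_def H_def EP_def ES_def Q_def N_def)
  have fin: "finite F" "finite H" "finite EP" "finite ES" "finite Q"
    using sub finE finite_subset by blast+
  have E_un: "E = F \<union> H \<union> Q \<union> EP \<union> ES" using sub by (auto simp: Q_def)
  have F_elem: "\<exists>u v. e = {u, v} \<and> u \<noteq> v \<and> u \<in> W \<and> v \<in> W" if "e \<in> F" for e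
    using that EV[of e] by (auto simp: F_def card_2_iff)
  have H_elem: "\<exists>u v. e = {u, v} \<and> u \<noteq> v \<and> u \<in> N \<and> v \<in> N" if "e \<in> H" for e
    using that EV[of e] by (auto simp: H_def card_2_iff)
  have Q_elem: "\<exists>w v. e = {w, v} \<and> w \<in> A \<and> v \<in> N" if "e \<in> Q" for e
  proof -
    have e: "e \<in> E" "e \<notin> F" "e \<notin> H" "e \<notin> ES" using \<open>e \<in> Q\<close> by (auto simp: Q_def)
    obtain u v where uv: "e = {u, v}" "u \<noteq> v" "u \<in> V" "v \<in> V"
      using EV[OF e(1)] by (auto simp: card_2_iff)
    have "u \<noteq> x" using e(1,4) uv(1) by (auto simp: N_def ES_def)
    moreover have "v \<noteq> x" using e(1,4) uv(1) by (auto simp: N_def ES_def insert_commute)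
    ultimately have "u \<in> N \<and> v \<in> W \<or> u \<in> W \<and> v \<in> N"
      using uv e by (auto simp: V F_def H_def)
    then show ?thesis
    proof
      assume *: "u \<in> N \<and> v \<in> W"
      then have "v \<in> A" using e(1) uv(1) by (auto simp: A_def insert_commute)
      then show ?thesis using * uv(1) by (metis insert_commute)
    next
      assume *: "u \<in> W \<and> v \<in> N"
      then have "u \<in> A" using e(1) uv(1) by (auto simp: A_def)
      then show ?thesis using * uv(1) by blast
    qed
  qed
  have disjE: "F \<inter> H = {}" "(F \<union> H) \<inter> Q = {}" "(F \<union> H \<union> Q) \<inter> EP = {}" "(F \<union> H \<union> Q \<union> EP) \<inter> ES = {}"
  proof -
    show "F \<inter> H = {}" using F_elem disj(2) by (fastforce simp: H_def)
    show "(F \<union> H) \<inter> Q = {}" by (auto simp: Q_def)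
    have "EP \<inter> (F \<union> H) = {}" using par AW disj(2) by (auto simp: EP_def F_def H_def)
    then show "(F \<union> H \<union> Q) \<inter> EP = {}" by (auto simp: Q_def)
    have "ES \<inter> (F \<union> H \<union> EP) = {}"
      using xN disj AW par by (auto simp: ES_def F_def H_def EP_def doubleton_eq_iff)
    then show "(F \<union> H \<union> Q \<union> EP) \<inter> ES = {}" by (auto simp: Q_def)
  qed
  have injP: "inj_on (\<lambda>a. {a, par a}) A"
    using par AW disj(2) by (fastforce simp: inj_on_def doubleton_eq_iff)
  have injS: "inj_on (\<lambda>v. {x, v}) N" by (auto simp: inj_on_def doubleton_eq_iff)
  have cardE: "card E = card F + card H + card Q + card A + card N"
  proof -
    have "card E = card F + card H + card Q + card EP + card ES"
      unfolding E_un using disjE fin by (simp add: card_Un_disjoint)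
    then show ?thesis using card_image[OF injP] card_image[OF injS] by (simp add: EP_def ES_def)
  qed
  \<comment> \<open>The labels below \<open>c\<close> go to the edges in \<open>F\<close>, \<open>H\<close> and \<open>Q\<close>, the others to those in \<open>EP\<close> and \<open>ES\<close>.\<close>
  define c where "c = card F + card H + card Q + 1"
  \<comment> \<open>Vertices of \<open>W - A\<close> have neighbours only in \<open>W\<close>, so an
    edge by which a path to \<open>x\<close> leaves \<open>X\<close> belongs to
    \<open>F\<close>.\<close>
  have reach: "\<exists>e\<in>F. e \<inter> X \<noteq> {} \<and> \<not> e \<subseteq> X" if X: "X \<subseteq> W - A" "X \<noteq> {}" for X
  proof -
    obtain b where b: "b \<in> X" using X(2) by blast
    then have "b \<in> V" using X(1) V by blast
    then have path: "(b, x) \<in> {(x, y). adjacent E x y}\<^sup>*"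
      using conn xV by (simp add: connected_graph_def)
    have "x \<notin> X" using X(1) disj(1) by blast
    from rtrancl_exit[OF path b this] obtain y z where yz: "y \<in> X" "z \<notin> X" "{y, z} \<in> E"
      unfolding adjacent_def by blast
    have y: "y \<in> W" "y \<notin> A" using yz(1) X(1) by auto
    have "z \<in> V" using EV[OF yz(3)] by blast
    moreover have "z \<noteq> x" using yz(3) y(1) disj(2) by (auto simp: N_def insert_commute)
    moreover have "z \<notin> N" using yz(3) y by (auto simp: A_def)
    ultimately have "{y, z} \<in> F" using yz(3) y(1) by (auto simp: F_def V)
    then show ?thesis using yz by (intro bexI[of _ "{y, z}"]) auto
  qed
  \<comment> \<open>Otherwise \<open>reach\<close> would apply to \<open>W\<close> itself, but no
    edge of \<open>F\<close> leaves \<open>W\<close>.\<close>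
  have WA: "W = {}" if "A = {}"
    using reach[of W] that by (auto simp: F_def)
  \<comment> \<open>The vertex \<open>par a\<close> is adjacent to both \<open>a\<close> and
    \<open>x\<close>, and its degree is at most that of \<open>x\<close>.\<close>
  have N2: "card N \<ge> 2" if "a \<in> A" for a
  proof -
    have "par a \<in> N" "{a, par a} \<in> E" "{x, par a} \<in> E" using par[OF that] by (auto simp: N_def)
    moreover have "a \<noteq> x" using that AW disj(1) by blast
    ultimately have "{{a, par a}, {x, par a}} \<subseteq> {e \<in> E. par a \<in> e}" "{a, par a} \<noteq> {x, par a}"
      by (auto simp: doubleton_eq_iff)
    then have "2 \<le> degree E (par a)"
      unfolding degree_def using card_mono[of "{e \<in> E. par a \<in> e}" "{{a, par a}, {x, par a}}"] finE
      by simp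
    then show ?thesis using deg[of "par a"] \<open>par a \<in> N\<close> NV by fastforce
  qed
  \<comment> \<open>The first inequality keeps the sum at \<open>x\<close> below the sums in
    \<open>A\<close>; the second makes the labels \<open>{c..<c + card W}\<close> available. For
    \<open>card N = 2\<close> the first one reads \<open>card W < 3\<close>.\<close>
  have kN: "card W < card N + card N * (card N - 1) div 2" "card W \<le> card N + card A"
    if "W \<noteq> {}"
  proof -
    obtain a where a: "a \<in> A" using WA \<open>W \<noteq> {}\<close> by blast
    then have "card A \<ge> 1" using finA by (metis One_nat_def Suc_leI card_gt_0_iff empty_iff)
    then show "card W \<le> card N + card A" using k N2[OF a] by linarith
    show "card W < card N + card N * (card N - 1) div 2"
    proof (cases "card N = 2")
      case True
      then show ?thesis using k by simp
    next
      case False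
      then have "card N \<ge> 3" using N2[OF a] by simp
      then have "3 * 2 \<le> card N * (card N - 1)" by (intro mult_le_mono) auto
      then have "3 \<le> card N * (card N - 1) div 2" by linarith
      then show ?thesis using k(1) \<open>card N \<ge> 3\<close> by linarith
    qed
  qed
  have FW: "e \<subseteq> W \<and> card e = 2" if "e \<in> F" for e using that EV by (auto simp: F_def)
  have cF: "card F < c" by (simp add: c_def)

  \<comment> \<open>Labellings of \<open>F\<close>, \<open>H\<close> and \<open>Q\<close> with the
    labels below \<open>c\<close>\<close>
  obtain xsW L u where W: "labelled xsW F L" "L \<subseteq> {1..<c}" "u < c"
    "\<And>l. l \<in> {1..<c} - L \<Longrightarrow> l + u < c" "inj_on (net xsW) (W - A)"
    "\<And>b. b \<in> W - A \<Longrightarrow> net xsW b \<le> int u" "\<And>a. a \<in> A \<Longrightarrow> net xsW a \<le> int (c + u)"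
    using small_graph_labelling[OF finW k(1) AW FW reach cF] by blast
  have cardR: "card ({1..<c} - L) = card H + card Q"
    using card_Diff_subset[OF card_labelled(1)[OF W(1)] W(2)] card_labelled(2)[OF W(1)]
    by (simp add: c_def)
  then have "card H \<le> card ({1..<c} - L)" by simp
  then obtain LH where LH: "LH \<subseteq> {1..<c} - L" "card LH = card H"
    by (meson obtain_subset_with_card_n)
  define LQ where "LQ = {1..<c} - L - LH"
  have finLH: "finite LH" using LH(1) finite_subset by blast
  have LQ: "finite LQ" "card LQ = card Q"
    using cardR LH finLH by (simp_all add: LQ_def card_Diff_subset)
  have H2: "card e = 2" if "e \<in> H" for e using that EV by (auto simp: H_def)
  have LHb: "l \<le> c - 1 - u" if "l \<in> LH" for l using W(4)[of l] LH(1) that by auto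
  obtain xsH where H: "labelled xsH H LH" "\<And>v. net xsH v \<ge> - int (c - 1 - u)"
    using balanced_labelling[OF fin(2) H2 finLH LH(2) LHb] by metis
  have "\<forall>e\<in>Q. \<exists>p. e = {fst p, snd p} \<and> fst p \<in> A \<and> snd p \<in> N"
    using Q_elem by (metis fst_conv snd_conv)
  from bchoice[OF this] obtain qp where
    "\<forall>e\<in>Q. e = {fst (qp e), snd (qp e)} \<and> fst (qp e) \<in> A \<and> snd (qp e) \<in> N" by blast
  note q = bspec[OF this]
  define qw qv where "qw e = fst (qp e)" and "qv e = snd (qp e)" for e
  note q = q[folded qw_def qv_def]
  obtain qs where qs: "set qs = Q" "distinct qs" using finite_distinct_list[OF fin(5)] by blast
  obtain ql where ql: "bij_betw ql Q LQ" using finite_same_card_bij[OF fin(5) LQ(1)] LQ(2) by auto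
  define xsQ where "xsQ = map (\<lambda>e. (qw e, qv e, ql e)) qs"
  have Qid: "(\<lambda>e. {qw e, qv e}) ` Q = Q" "inj_on (\<lambda>e. {qw e, qv e}) Q"
  proof -
    have "\<And>e. e \<in> Q \<Longrightarrow> {qw e, qv e} = e" using q by simp
    then show "(\<lambda>e. {qw e, qv e}) ` Q = Q" "inj_on (\<lambda>e. {qw e, qv e}) Q"
      by (auto simp: inj_on_def)
  qed
  have Q: "labelled xsQ Q LQ"
    using labelled_map[of qs qw qv ql] qs Qid ql by (simp add: xsQ_def bij_betw_def)
  have Q_mem: "u \<in> A \<and> w \<in> N" if "(u, w, l) \<in> set xsQ" for u w l
    using that q qs(1) by (auto simp: xsQ_def)
  have netQ_W: "net xsQ w \<le> 0" if "w \<in> W" for w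
    using that Q_mem disj(2) by (intro net_nonpos) blast
  have netQ_N: "net xsQ v \<ge> 0" if "v \<in> N" for v
    using that Q_mem disj(2) AW by (intro net_nonneg) blast
  have netQ_0: "net xsQ v = 0" if "v \<notin> A" "v \<notin> N" for v
  proof (rule net_zero[OF Q])
    fix e assume "e \<in> Q"
    then show "v \<notin> e" using Q_elem[of e] that by auto
  qed

  \<comment> \<open>Labels of the picked edges and of the edges at \<open>x\<close>\<close>
  have "card A + card (net xsW ` (W - A)) \<le> card {c..<c + card W}"
  proof -
    have "card (net xsW ` (W - A)) \<le> card W - card A"
      using card_image_le[of "W - A" "net xsW"] finW AW finA by (simp add: card_Diff_subset)
    moreover have "card A \<le> card W" using AW finW by (rule card_mono[rotated])
    ultimately show ?thesis by simp
  qed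
  \<comment> \<open>The vertices of \<open>W - A\<close> forbid at most
    \<open>card W - card A\<close> values, so \<open>card W\<close> candidate labels suffice.
    Offering the smallest labels from \<open>c\<close> on keeps the sums in \<open>A\<close> from
    falling too far towards the one at \<open>x\<close>.\<close>
  then obtain f where f: "inj_on f A" "f ` A \<subseteq> {c..<c + card W}"
    "inj_on (\<lambda>a. net xsW a + net xsQ a - int (f a)) A"
    "\<forall>a\<in>A. net xsW a + net xsQ a - int (f a) \<notin> net xsW ` (W - A)"
    using distinct_differences[of A "{c..<c + card W}" "net xsW ` (W - A)" "\<lambda>a. net xsW a + net xsQ a"]
      finA finW by auto
  obtain as where as: "set as = A" "distinct as" using finite_distinct_list[OF finA] by blast
  define xsP where "xsP = map (\<lambda>a. (a, par a, f a)) as"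
  have P: "labelled xsP EP (f ` A)"
    using labelled_map[of as "\<lambda>a. a" par f] as injP f(1) by (simp add: xsP_def EP_def)
  have P_mem: "u \<in> A \<and> w \<in> N" if "(u, w, l) \<in> set xsP" for u w l
    using that par as(1) by (auto simp: xsP_def)
  have netP_N: "net xsP v \<ge> 0" if "v \<in> N" for v
    using that P_mem disj(2) AW by (intro net_nonneg) blast
  have netP_0: "net xsP v = 0" if "v \<notin> A" "v \<notin> N" for v
    using P by (rule net_zero) (use that par in \<open>auto simp: EP_def\<close>)
  have netP_A: "net xsP a = - int (f a)" if "a \<in> A" for a
  proof -
    have "net xsP a = (\<Sum>b\<in>A. if b = a then - int (f a) else 0)"
      unfolding xsP_def net_map[OF as(2)] as(1)
      by (rule sum.cong) (use par that AW disj(2) in auto)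
    then show ?thesis using that finA by simp
  qed
  define K where "K = {c..card E} - f ` A"
  have cE: "c + card A + card N = card E + 1" using cardE by (simp add: c_def)
  have fA: "f ` A \<subseteq> {c..card E}"
  proof (cases "W = {}")
    case True
    then show ?thesis using AW by simp
  next
    case False
    then show ?thesis using f(2) kN(2) cE by fastforce
  qed
  have K: "finite K" "card K = card N" "\<And>l. l \<in> K \<Longrightarrow> c \<le> l"
    using fA card_image[OF f(1)] cE finA by (auto simp: K_def card_Diff_subset)
  define base where "base v = net xsH v + net xsQ v + net xsP v" for v
  \<comment> \<open>Applied to \<open>- base\<close>, the lemma makes the values
    \<open>base v + int (g v)\<close> distinct. No value is forbidden, since \<open>N\<close> is
    separated from the other vertices by size.\<close>
  obtain g where g: "inj_on g N" "g ` N \<subseteq> K" "inj_on (\<lambda>v. - base v - int (g v)) N"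
    using distinct_differences[of N K "{}" "\<lambda>v. - base v"] finN K by auto
  have gK: "g ` N = K" using g(1,2) K(1,2) by (metis card_image card_subset_eq)
  obtain ns where ns: "set ns = N" "distinct ns" using finite_distinct_list[OF finN] by blast
  define xsS where "xsS = map (\<lambda>v. (x, v, g v)) ns"
  have S: "labelled xsS ES K"
    using labelled_map[of ns "\<lambda>v. x" "\<lambda>v. v" g] ns injS g(1) gK by (simp add: xsS_def ES_def)
  have netS_0: "net xsS v = 0" if "v \<in> W" for v
    using S by (rule net_zero) (use that disj in \<open>auto simp: ES_def\<close>)
  have netS_N: "net xsS v = int (g v)" if "v \<in> N" for v
  proof -
    have "net xsS v = (\<Sum>b\<in>N. if b = v then int (g v) else 0)"
      unfolding xsS_def net_map[OF ns(2)] ns(1)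
      by (rule sum.cong) (use that xN in auto)
    then show ?thesis using that finN by simp
  qed
  have netS_x: "net xsS x = - int (\<Sum>K)"
  proof -
    have "net xsS x = (\<Sum>b\<in>N. - int (g b))"
      unfolding xsS_def net_map[OF ns(2)] ns(1)
      by (rule sum.cong) (use xN in auto)
    also have "\<dots> = - int (\<Sum>b\<in>N. g b)" by (simp add: sum_negf)
    also have "(\<Sum>b\<in>N. g b) = \<Sum>K" using sum.reindex[OF g(1), of "\<lambda>l. l"] gK by simp
    finally show ?thesis .
  qed

  \<comment> \<open>The combined labelling and its sums\<close>
  define xs where "xs = (((xsW @ xsH) @ xsQ) @ xsP) @ xsS"
  have labels: "L \<inter> LH = {}" "(L \<union> LH) \<inter> LQ = {}" "L \<union> LH \<union> LQ = {1..<c}"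
    "{1..<c} \<inter> f ` A = {}" "({1..<c} \<union> f ` A) \<inter> K = {}" "{1..<c} \<union> f ` A \<union> K = {1..card E}"
    using LH(1) W(2) fA cE by (auto simp: LQ_def K_def c_def)
  note lab1 = labelled_append[OF W(1) H(1) disjE(1) labels(1)]
  note lab2 = labelled_append[OF lab1 Q disjE(2) labels(2), unfolded labels(3)]
  note lab3 = labelled_append[OF lab2 P disjE(3) labels(4)]
  have lab: "labelled xs E {1..card E}"
    using labelled_append[OF lab3 S disjE(4) labels(5)]
    unfolding labels(6) E_un[symmetric] xs_def .
  have netW_0: "net xsW v = 0" if "v \<notin> W" for v
    using W(1) by (rule net_zero) (use that in \<open>auto simp: F_def\<close>)
  have netH_0: "net xsH v = 0" if "v \<notin> N" for v
    using H(1) by (rule net_zero) (use that in \<open>auto simp: H_def\<close>)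
  have net_x: "net xs x = - int (\<Sum>K)"
  proof -
    have "x \<notin> A" using disj(1) AW by blast
    then show ?thesis
      using netW_0[of x] netH_0[of x] netQ_0[of x] netP_0[of x] netS_x disj(1) xN by (simp add: xs_def)
  qed
  have net_N: "net xs v = base v + int (g v)" if "v \<in> N" for v
  proof -
    have "v \<notin> W" using that disj(2) by blast
    then show ?thesis using netW_0[of v] netS_N[OF that] by (simp add: xs_def base_def)
  qed
  have net_A: "net xs a = net xsW a + net xsQ a - int (f a)" if "a \<in> A" for a
  proof -
    have "a \<in> W" "a \<notin> N" using that AW disj(2) by blast+
    then show ?thesis using netH_0[of a] netS_0[of a] netP_A[OF that] by (simp add: xs_def)
  qed
  have net_B: "net xs b = net xsW b" if "b \<in> W - A" for b
  proof -
    have "b \<in> W" "b \<notin> A" "b \<notin> N" using that disj(2) by blast+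
    then show ?thesis
      using netH_0[of b] netS_0[of b] netP_0[of b] netQ_0[of b] by (simp add: xs_def)
  qed
  \<comment> \<open>On \<open>A\<close> the outgoing picked edge takes off at least
    \<open>c\<close>, which brings the bound \<open>c + u\<close> down to \<open>u\<close>.\<close>
  have W_le: "net xs w \<le> int u" if "w \<in> W" for w
  proof (cases "w \<in> A")
    case True
    have "f w \<ge> c" using f(2) True by auto
    then show ?thesis using net_A[OF True] W(7)[OF True] netQ_W[OF that] by simp
  next
    case False
    then show ?thesis using net_B W(6) that by simp
  qed
  \<comment> \<open>The edge from \<open>x\<close> adds at least \<open>c\<close>, while
    \<open>base\<close> is at least \<open>- (c - 1 - u)\<close>.\<close>
  have N_gt: "net xs v > int u" if "v \<in> N" for v
  proof -
    have "g v \<ge> c" using g(2) K(3) that by auto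
    then show ?thesis
      using net_N[OF that] H(2)[of v] netQ_N[OF that] netP_N[OF that] W(3) by (simp add: base_def)
  qed
  have sumK: "\<Sum>K \<ge> card N * c + card N * (card N - 1) div 2"
    using sum_distinct_ge[OF K(1,3)] K(2) by simp
  \<comment> \<open>The vertex \<open>x\<close> loses \<open>card N\<close> distinct labels, all at
    least \<open>c\<close>. A vertex of \<open>W\<close> has at most \<open>card N\<close> edges, of
    which only a picked one can carry a label as large as \<open>c\<close>; that edge is counted
    separately.\<close>
  have x_lt: "net xs x < net xs w" if "w \<in> W" for w
  proof -
    have "W \<noteq> {}" using that by blast
    then obtain a where "a \<in> A" using WA by blast
    then have N2: "card N \<ge> 2" by (rule N2)
    have FQ: "labelled (xsW @ xsQ) (F \<union> Q) (L \<union> LQ)"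
      using W(1) Q disjE(2) labels(2) by (intro labelled_append) auto
    have "l \<le> c - 1" if "l \<in> L \<union> LQ" for l
    proof -
      have "l \<in> {1..<c}" using that labels(3) by blast
      then show ?thesis by auto
    qed
    from net_ge_degree[OF FQ this, of w]
    have ge: "net xsW w + net xsQ w \<ge> - int ((c - 1) * degree (F \<union> Q) w)" by simp
    have "w \<in> V" using that V by blast
    then have degw: "degree E w \<le> card N" by (rule deg)
    show ?thesis
    proof (cases "w \<in> A")
      case True
      have "{e \<in> F \<union> Q. w \<in> e} \<subseteq> {e \<in> E. w \<in> e} - {{w, par w}}"
        using sub disjE(3) True by (auto simp: EP_def)
      then have "degree (F \<union> Q) w \<le> card ({e \<in> E. w \<in> e} - {{w, par w}})"
        unfolding degree_def using finE by (intro card_mono) auto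
      also have "\<dots> = degree E w - 1"
        unfolding degree_def using par[OF True] finE by (simp add: card_Diff_singleton)
      finally have "degree (F \<union> Q) w \<le> card N - 1" using degw by simp
      then have "(c - 1) * degree (F \<union> Q) w \<le> (c - 1) * (card N - 1)" by (rule mult_le_mono2)
      moreover have "(c - 1) * (card N - 1) + c + card N = card N * c + 1"
      proof -
        obtain c' n where "c = Suc c'" "card N = Suc n" using N2 by (cases c; cases "card N") (auto simp: c_def)
        then show ?thesis by (simp add: algebra_simps)
      qed
      moreover have "f w < c + card W" using f(2) True by auto
      \<comment> \<open>Instantiated with \<open>z\<close> as \<open>card N * c\<close>,
        \<open>h\<close> as \<open>card N * (card N - 1) div 2\<close>, \<open>k\<close> as
        \<open>card W\<close> and \<open>s\<close> as \<open>\<Sum>K\<close>; the products stay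
        opaque to linear arithmetic.\<close>
      moreover have "p + fw < s" if "p \<le> q" "q + c + n = z + 1" "fw < c + k" "z + h \<le> s" "k < n + h"
        for p q n z fw k h s :: nat
        using that by linarith
      ultimately have "(c - 1) * degree (F \<union> Q) w + f w < \<Sum>K"
        using sumK kN(1)[OF \<open>W \<noteq> {}\<close>] by blast
      then show ?thesis using ge net_A[OF True] net_x by linarith
    next
      case False
      have "degree (F \<union> Q) w \<le> degree E w"
        unfolding degree_def using finE sub by (intro card_mono) auto
      then have "(c - 1) * degree (F \<union> Q) w \<le> (c - 1) * card N" using degw by (intro mult_le_mono2) simp
      also have "\<dots> < c * card N" using N2 by (simp add: c_def)
      also have "\<dots> \<le> \<Sum>K" using sumK by (simp add: mult.commute)
      finally have "(c - 1) * degree (F \<union> Q) w < \<Sum>K" .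
      moreover have "w \<in> W - A" "w \<notin> N" using that False disj(2) by auto
      then have "net xs w = net xsW w" "net xsQ w = 0" using net_B netQ_0 by auto
      ultimately show ?thesis using ge net_x by linarith
    qed
  qed
  have "inj_on (net xs) V"
  proof -
    have "inj_on (net xs) A"
      using f(3) net_A by (simp cong: inj_on_cong)
    moreover have "inj_on (net xs) (W - A)"
    proof -
      have "inj_on (net xs) (W - A) = inj_on (net xsW) (W - A)" by (rule inj_on_cong) (rule net_B)
      then show ?thesis using W(5) by simp
    qed
    moreover have "net xs ` A \<inter> net xs ` (W - A) = {}"
    proof -
      have "net xs ` (W - A) = net xsW ` (W - A)" by (rule image_cong[OF refl net_B])
      then show ?thesis using f(4) net_A by force
    qed
    ultimately have "inj_on (net xs) (A \<union> (W - A))"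
      by (subst inj_on_Un) (simp add: Diff_Diff_Int Diff_triv)
    then have "inj_on (net xs) W" using AW by (simp add: Un_absorb1)
    moreover have "inj_on (net xs) N"
    proof (rule inj_onI)
      fix v w assume vw: "v \<in> N" "w \<in> N" "net xs v = net xs w"
      then have "- base v - int (g v) = - base w - int (g w)" using net_N by simp
      then show "v = w" using inj_onD[OF g(3)] vw(1,2) by blast
    qed
    moreover have "net xs v \<noteq> net xs w" if "v \<in> N" "w \<in> W" for v w
      using N_gt[OF that(1)] W_le[OF that(2)] by simp
    ultimately have "inj_on (net xs) (N \<union> W)"
      by (auto simp: inj_on_def) metis
    moreover have "net xs x \<noteq> net xs v" if "v \<in> N \<union> W" for v
    proof (cases "v \<in> W")
      case True
      then show ?thesis using x_lt by (metis less_irrefl)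
    next
      case False
      then have "net xs v > int u" using that N_gt by blast
      moreover have "net xs x \<le> 0" unfolding net_x by (simp del: of_nat_sum)
      ultimately show ?thesis by linarith
    qed
    ultimately show ?thesis unfolding V inj_on_insert by blast
  qed
  then show ?thesis using antimagic_of_labelled[OF lab] by blast
qed

theorem theorem1p2:
  fixes V :: "'a set" and E :: "'a set set"
  assumes "simple_graph V E" and "connected_graph V E"
  shows "(max_degree V E + 3 \<ge> card V \<longrightarrow> has_antimagic_orientation V E) \<and>
         (\<forall>t::nat. t \<in> {4, 5} \<and> max_degree V E + t = card V \<and> max_degree V E \<ge> 4
              \<longrightarrow> has_antimagic_orientation V E)"
proof -
  have V: "finite V" "V \<noteq> {}"
    using assms by (auto simp: simple_graph_def connected_graph_def)
  then have "max_degree V E \<in> degree E ` V" unfolding max_degree_def by (intro Max_in) auto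
  then obtain x where x: "x \<in> V" "degree E x = max_degree V E" by auto
  define N where "N = {v. {x, v} \<in> E}"
  have "x \<notin> N" "N \<subseteq> V"
    using assms(1) by (auto simp: N_def simple_graph_def)
  have "{e \<in> E. x \<in> e} = (\<lambda>v. {x, v}) ` N"
  proof
    show "{e \<in> E. x \<in> e} \<subseteq> (\<lambda>v. {x, v}) ` N"
    proof
      fix e assume e: "e \<in> {e \<in> E. x \<in> e}"
      then have "card e = 2" using assms(1) by (simp add: simple_graph_def)
      then obtain v where "e = {x, v}" using e by (auto simp: card_2_iff)
      then show "e \<in> (\<lambda>v. {x, v}) ` N" using e by (auto simp: N_def)
    qed
  qed (auto simp: N_def)
  moreover have "inj_on (\<lambda>v. {x, v}) N" by (auto simp: inj_on_def doubleton_eq_iff)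
  ultimately have N: "card N = max_degree V E"
    using x(2) by (simp add: degree_def card_image)
  have deg: "degree E v \<le> card N" if "v \<in> V" for v
    unfolding N max_degree_def using V that by simp
  have cardW: "card (V - insert x N) = card V - Suc (max_degree V E)"
  proof -
    have "finite N" using \<open>N \<subseteq> V\<close> V(1) finite_subset by blast
    then show ?thesis using x(1) \<open>x \<notin> N\<close> \<open>N \<subseteq> V\<close> N by (subst card_Diff_subset) auto
  qed
  note main = antimagic_few_non_neighbours[OF assms x(1) N_def deg refl]
  show ?thesis
  proof (intro conjI allI impI)
    assume "card V \<le> max_degree V E + 3"
    \<comment> \<open>Here at most two vertices other than \<open>x\<close> are not adjacent to
      \<open>x\<close>.\<close>
    then show "has_antimagic_orientation V E" by (intro main disjI1) (simp_all add: cardW)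
  next
    fix t :: nat
    assume "t \<in> {4, 5} \<and> max_degree V E + t = card V \<and> 4 \<le> max_degree V E"
    \<comment> \<open>Now \<open>W\<close> has \<open>t - 1\<close> elements, three or four, and
      \<open>card N\<close> is at least 4.\<close>
    then show "has_antimagic_orientation V E" by (intro main) (auto simp: cardW N)
  qed
qed

end
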